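(* Let $T$ be a tree of order $n\geq 2$ with $\ell$ leaves and $s$ support vertices, such that $C(T)\neq\emptyset$. Then $$\gamma_{s}(T)\geq \frac{\left(2\lceil\frac{\delta^{*}}{2}\rceil-1\right)n+2(\ell-s+2)}{2\lceil\frac{\delta^{*}}{2}\rceil+1},$$ and this bound is sharp, i.e., equality holds for some such tree.
   Context: A signed dominating function (SDF) of $T$ is a function $f:V(T)\to\{-1,1\}$ with $f(N[v])=\sum_{u\in N[v]}f(u)\geq 1$ for every vertex $v$, where $N[v]$ is the closed neighborhood; $\gamma_s(T)$ is the minimum of $\sum_{v} f(v)$ over all SDFs. A leaf is a vertex of degree $1$; a support vertex is a vertex adjacent to a leaf. Let $C(T)$ be the set of vertices of $T$ that are neither isolated, nor leaves, nor support vertices, and $\delta^{*}=\min\{\deg(v): v\in C(T)\}$. *)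

theory Defs
  imports Complex_Main "HOL-Library.FuncSet" "Graph_Theory.Digraph_Component"
begin

text \<open>
  Finite simple undirected graphs are modelled by \<^locale>\<open>pair_graph\<close>: a finite vertex set with a
  symmetric, irreflexive arc set, each undirected edge \<open>uv\<close> being the two arcs \<open>(u, v)\<close> and
  \<open>(v, u)\<close>. The library's \<open>forest\<close> and \<open>tree\<close> forbid all directed cycles, hence also the
  back-and-forth cycle along one edge, so they are unsuitable here. Directed cycles of length at
  least 3 in a symmetric digraph are exactly the cycles of the undirected graph.
\<close>

definition undirected_tree :: "'a pair_pre_digraph \<Rightarrow> bool" where
  "undirected_tree G \<longleftrightarrow>
     pair_graph G \<and> Digraph_Component.connected (with_proj G) \<and>
     \<not> (\<exists>p. pre_digraph.cycle (with_proj G) p \<and> length p \<ge> 3)"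

text \<open>In a symmetric loop-free pair digraph the out-degree is the undirected degree.\<close>

abbreviation deg :: "'a pair_pre_digraph \<Rightarrow> 'a \<Rightarrow> nat" where
  "deg G v \<equiv> out_degree (with_proj G) v"

definition closed_nbhd :: "'a pair_pre_digraph \<Rightarrow> 'a \<Rightarrow> 'a set" where
  "closed_nbhd G v = insert v {u. (v, u) \<in> parcs G}"

definition leaves :: "'a pair_pre_digraph \<Rightarrow> 'a set" where
  "leaves G = {v \<in> pverts G. deg G v = 1}"

definition support_verts :: "'a pair_pre_digraph \<Rightarrow> 'a set" where
  "support_verts G = {v \<in> pverts G. \<exists>u \<in> leaves G. (v, u) \<in> parcs G}"

definition core_verts :: "'a pair_pre_digraph \<Rightarrow> 'a set" where
  "core_verts G =
     {v \<in> pverts G. deg G v \<noteq> 0 \<and> v \<notin> leaves G \<and> v \<notin> support_verts G}"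

definition delta_star :: "'a pair_pre_digraph \<Rightarrow> nat" where
  "delta_star G = Min (deg G ` core_verts G)"

definition signed_dom_funs :: "'a pair_pre_digraph \<Rightarrow> ('a \<Rightarrow> int) set" where
  "signed_dom_funs G =
     {f \<in> pverts G \<rightarrow>\<^sub>E {-1, 1}. \<forall>v \<in> pverts G. (\<Sum>u \<in> closed_nbhd G v. f u) \<ge> 1}"

definition signed_dom_number :: "'a pair_pre_digraph \<Rightarrow> int" where
  "signed_dom_number G = Min ((\<lambda>f. \<Sum>v \<in> pverts G. f v) ` signed_dom_funs G)"

lemma finite_signed_dom_funs:
  assumes "pair_graph G"
  shows "finite (signed_dom_funs G)"
proof -
  interpret pair_graph G by fact
  have "finite (pverts G \<rightarrow>\<^sub>E {-1, 1 :: int})"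
    by (intro finite_PiE pair_finite_verts) auto
  then show ?thesis
    unfolding signed_dom_funs_def by simp
qed

lemma signed_dom_funs_nonempty:
  assumes "pair_graph G"
  shows "signed_dom_funs G \<noteq> {}"
proof -
  interpret pair_graph G by fact
  let ?f = "restrict (\<lambda>_. 1 :: int) (pverts G)"
  have "(\<Sum>u \<in> closed_nbhd G v. ?f u) \<ge> 1" if "v \<in> pverts G" for v
  proof -
    have sub: "closed_nbhd G v \<subseteq> pverts G"
      using that arc_snd_in_verts by (fastforce simp: closed_nbhd_def)
    then have "finite (closed_nbhd G v)"
      using pair_finite_verts finite_subset by blast
    moreover have "v \<in> closed_nbhd G v"
      by (simp add: closed_nbhd_def)
    ultimately have "card (closed_nbhd G v) \<ge> 1"
      by (metis One_nat_def Suc_leI card_gt_0_iff empty_iff)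
    moreover have "(\<Sum>u \<in> closed_nbhd G v. ?f u) = (\<Sum>u \<in> closed_nbhd G v. 1)"
      using sub by (intro sum.cong) auto
    ultimately show ?thesis by simp
  qed
  then have "?f \<in> signed_dom_funs G"
    unfolding signed_dom_funs_def by auto
  then show ?thesis by blast
qed

end

theory Submission
  imports Defs
begin

text \<open>
  Put $k = \lceil \delta^*/2 \rceil$. A negative vertex is neither a leaf nor a support vertex and
  has at least $k + 1$ positive neighbours, while every positive vertex has a positive neighbour.
  Delete all but one leaf at each support vertex. Both facts survive in the remaining forest, on
  the set $P$ of remaining positive vertices and the set $M$ of negative ones. It therefore has at
  least $|P|/2 + (k+1)|M|$ edges, but at most $|P| + |M| - 1$, so that $|P| \ge 2k|M| + 2$.
  Equality holds for the path on five vertices.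
\<close>

section \<open>Open neighbourhoods and degrees\<close>

definition nbrs :: "'a pair_pre_digraph \<Rightarrow> 'a \<Rightarrow> 'a set" where
  "nbrs G v = {u. (v, u) \<in> parcs G}"

lemma in_nbrs_iff [simp]: "u \<in> nbrs G v \<longleftrightarrow> (v, u) \<in> parcs G"
  by (simp add: nbrs_def)

lemma deg_eq_card_nbrs: "deg G v = card (nbrs G v)"
proof -
  have "out_arcs (with_proj G) v = Pair v ` nbrs G v"
    by (auto simp: out_arcs_def)
  then show ?thesis
    by (simp add: out_degree_def card_image inj_on_def)
qed

lemma closed_nbhd_eq_insert_nbrs: "closed_nbhd G v = insert v (nbrs G v)"
  by (auto simp: closed_nbhd_def)

context pair_graph
begin

lemma nbrs_subset_verts: "nbrs G v \<subseteq> pverts G"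
  by (auto dest: in_arcsD2)

lemma finite_nbrs: "finite (nbrs G v)"
  using nbrs_subset_verts pair_finite_verts finite_subset by blast

lemma not_in_nbrs_self: "v \<notin> nbrs G v"
  by (auto dest: no_loops')

section \<open>Edge counts in acyclic graphs\<close>

text \<open>Take a longest path inside \<open>W\<close>. Its first vertex has a neighbour in
  \<open>W\<close> other than the second vertex of the path; by maximality that neighbour lies on
  the path, which closes a cycle.\<close>

lemma min_degree_two_imp_cycle:
  assumes "W \<subseteq> pverts G" "W \<noteq> {}"
    and two: "\<And>v w. v \<in> W \<Longrightarrow> \<exists>z \<in> W. z \<noteq> w \<and> (v, z) \<in> parcs G"
  shows "\<exists>p. cycle p \<and> length p \<ge> 3"
proof -
  define Q where "Q p \<longleftrightarrow> (\<exists>u v. apath u p v \<and> set (pawalk_verts u p) \<subseteq> W)" for p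
  obtain w0 where "w0 \<in> W" using assms by blast
  then have "Q []"
    using assms unfolding Q_def by (auto simp: apath_Nil_iff intro!: exI[of _ w0])
  moreover have "\<forall>p. Q p \<longrightarrow> length p < card (pverts G)"
    unfolding Q_def using length_apath_less by blast
  ultimately obtain p where "Q p" and max: "\<And>q. Q q \<Longrightarrow> length q \<le> length p"
    using ex_has_greatest_nat[of Q "[]" length "card (pverts G)"] by (metis less_imp_le)
  then obtain u v where p: "apath u p v" "set (pawalk_verts u p) \<subseteq> W"
    unfolding Q_def by blast
  have uW: "u \<in> W"
    using p by (cases p) (auto simp: apath_def awalk_Cons_iff)
  \<comment> \<open>\<open>w\<close> is the second vertex of the path. On the trivial path it is
    \<open>u\<close> itself, so that \<open>z\<close> differs from \<open>u\<close> in the case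
    \<open>q = []\<close> below.\<close>
  define w where "w = (if p = [] then u else snd (hd p))"
  obtain z where z: "z \<in> W" "z \<noteq> w" "(u, z) \<in> parcs G"
    using two uW by blast
  then have zu: "(z, u) \<in> parcs G" "z \<noteq> u"
    using arcs_symmetric no_loops' by blast+
  \<comment> \<open>Otherwise prepending the arc \<open>(z, u)\<close> gives a longer path in
    \<open>W\<close>.\<close>
  have "z \<in> set (pawalk_verts u p)"
  proof (rule ccontr)
    assume "z \<notin> set (pawalk_verts u p)"
    then have "apath z ((z, u) # p) v"
      using p zu by (auto simp: apath_def awalk_Cons_iff)
    then have "Q ((z, u) # p)"
      unfolding Q_def using p z by auto
    then show False using max by fastforce
  qed
  then obtain q r where qr: "p = q @ r" "awalk u q z"
    using p awalk_decomp unfolding apath_def by blast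
  then have "distinct (pawalk_verts u q)"
    using p by (auto simp: apath_def awalk_append_iff awalk_verts_append)
  then have "cycle ((z, u) # q)"
    using qr zu unfolding cycle_def by (auto simp: awalk_Cons_iff intro!: exI[of _ z])
  \<comment> \<open>An initial segment of length 0 or 1 from \<open>u\<close> ends in
    \<open>u\<close> or in \<open>w\<close>, and \<open>z\<close> is neither. This rules out the
    back-and-forth cycle along one edge.\<close>
  moreover have "length q \<ge> 2"
  proof (rule ccontr)
    assume "\<not> length q \<ge> 2"
    then consider "q = []" | a where "q = [a]"
      by (cases q; cases "tl q") auto
    then show False
      using qr z zu by cases (auto simp: awalk_Cons_iff awalk_Nil_iff w_def)
  qed
  ultimately show ?thesis by (intro exI[of _ "(z, u) # q"]) auto
qed

text \<open>By \<open>min_degree_two_imp_cycle\<close> some vertex of \<open>W\<close> has at most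
  one neighbour in \<open>W\<close>; deleting it removes at most one edge, that is, two arcs. In
  terms of edges this is the forest bound \<open>card W - 1\<close>, doubled because arcs are
  counted.\<close>

lemma card_arcs_of_acyclic:
  assumes acyc: "\<not> (\<exists>p. cycle p \<and> length p \<ge> 3)"
    and "W \<subseteq> pverts G" "W \<noteq> {}"
  shows "card (parcs G \<inter> W \<times> W) + 2 \<le> 2 * card W"
  using assms(2-)
proof (induction "card W" arbitrary: W rule: less_induct)
  case less
  have fin: "finite W" using less pair_finite_verts finite_subset by blast
  \<comment> \<open>\<open>w\<close> is only the possible neighbour: \<open>v\<close> may have none
    in \<open>W\<close>.\<close>
  obtain v w where vw: "v \<in> W" "\<And>z. z \<in> W \<Longrightarrow> (v, z) \<in> parcs G \<Longrightarrow> z = w"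
  proof -
    have "\<not> (\<forall>v w. v \<in> W \<longrightarrow> (\<exists>z \<in> W. z \<noteq> w \<and> (v, z) \<in> parcs G))"
      using acyc min_degree_two_imp_cycle[OF less.prems] by meson
    then show ?thesis using that by blast
  qed
  let ?W = "W - {v}"
  show ?case
  proof (cases "?W = {}")
    case True
    then have "W = {v}" using vw by blast
    then have "parcs G \<inter> W \<times> W = {}" by (auto dest: no_loops')
    then show ?thesis using \<open>W = {v}\<close> by simp
  next
    case False
    have cW: "card W = Suc (card ?W)" using vw fin by (metis card.remove)
    have "card (parcs G \<inter> ?W \<times> ?W) + 2 \<le> 2 * card ?W"
      using less.hyps[of ?W] less.prems False cW by auto
    moreover have "parcs G \<inter> W \<times> W \<subseteq> (parcs G \<inter> ?W \<times> ?W) \<union> {(v, w), (w, v)}"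
    proof
      fix e assume e: "e \<in> parcs G \<inter> W \<times> W"
      obtain a b where ab: "e = (a, b)" by (cases e)
      with e have "(a, b) \<in> parcs G" "(b, a) \<in> parcs G" "a \<in> W" "b \<in> W"
        using arcs_symmetric by auto
      then show "e \<in> (parcs G \<inter> ?W \<times> ?W) \<union> {(v, w), (w, v)}"
        using vw(2)[of a] vw(2)[of b] ab by (cases "a = v"; cases "b = v") auto
    qed
    then have "card (parcs G \<inter> W \<times> W) \<le> card ((parcs G \<inter> ?W \<times> ?W) \<union> {(v, w), (w, v)})"
      using pair_finite_arcs by (intro card_mono) auto
    moreover have "\<dots> \<le> card (parcs G \<inter> ?W \<times> ?W) + card {(v, w), (w, v)}"
      by (rule card_Un_le)
    moreover have "card {(v, w), (w, v)} \<le> 2"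
      using card_length[of "[(v, w), (w, v)]"] by simp
    ultimately show ?thesis using cW by linarith
  qed
qed

section \<open>Leaves, and absence of isolated vertices\<close>

lemma leaf_nbrs:
  assumes "v \<in> leaves G"
  obtains w where "nbrs G v = {w}" "w \<in> support_verts G"
proof -
  obtain w where w: "nbrs G v = {w}"
    using assms by (auto simp: leaves_def deg_eq_card_nbrs card_1_singleton_iff)
  then have "(v, w) \<in> parcs G" by (metis in_nbrs_iff singletonI)
  then have "w \<in> support_verts G"
    using assms arcs_symmetric in_arcsD2 by (auto simp: support_verts_def)
  with w show ?thesis using that by blast
qed

text \<open>A walk from \<open>v\<close> to a second vertex starts with an arc leaving
  \<open>v\<close>.\<close>

lemma nbrs_nonempty_of_connected:
  assumes "Digraph_Component.connected (with_proj G)" "card (pverts G) \<ge> 2" "v \<in> pverts G"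
  shows "nbrs G v \<noteq> {}"
proof -
  have "\<not> pverts G \<subseteq> {v}"
    using assms(2) card_mono[of "{v}" "pverts G"] by auto
  then obtain u where u: "u \<in> pverts G" "u \<noteq> v" by blast
  have "strongly_connected (with_proj G)"
    using assms(1) pair_sym_arcs symmetric_connected_imp_strongly_connected by blast
  then have "v \<rightarrow>\<^sup>*\<^bsub>with_proj G\<^esub> u"
    using u assms(3) by (auto simp: strongly_connected_def)
  then obtain p where "awalk v p u" by (auto simp: reachable_awalk)
  then show ?thesis
    using u by (cases p) (auto simp: awalk_Nil_iff awalk_Cons_iff)
qed

end

section \<open>Positive and negative vertices of a signed dominating function\<close>

locale sdf_graph = pair_graph +
  fixes f :: "'a \<Rightarrow> int"
  assumes sdf: "f \<in> signed_dom_funs G"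
begin

definition Plus :: "'a set" where "Plus = {v \<in> pverts G. f v = 1}"
definition Minus :: "'a set" where "Minus = {v \<in> pverts G. f v = -1}"

lemma verts_eq_Plus_Un_Minus: "pverts G = Plus \<union> Minus"
  using sdf PiE_mem[of f "pverts G" "\<lambda>_. {-1, 1}"]
  by (auto simp: signed_dom_funs_def Plus_def Minus_def)

lemma Plus_Int_Minus: "Plus \<inter> Minus = {}"
  by (auto simp: Plus_def Minus_def)

lemma finite_Plus: "finite Plus" and finite_Minus: "finite Minus"
  using pair_finite_verts by (auto simp: Plus_def Minus_def)

lemma card_eq_Plus_Minus:
  assumes "A \<subseteq> pverts G"
  shows "card A = card (A \<inter> Plus) + card (A \<inter> Minus)"
proof -
  have "finite A" using assms pair_finite_verts finite_subset by blast
  moreover have "A = (A \<inter> Plus) \<union> (A \<inter> Minus)"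
    using assms verts_eq_Plus_Un_Minus by blast
  ultimately show ?thesis
    using Plus_Int_Minus card_Un_disjoint[of "A \<inter> Plus" "A \<inter> Minus"] by auto
qed

lemma sum_eq_Plus_Minus:
  assumes "A \<subseteq> pverts G"
  shows "sum f A = int (card (A \<inter> Plus)) - int (card (A \<inter> Minus))"
proof -
  have fin: "finite A" using assms pair_finite_verts finite_subset by blast
  have "sum f A = sum f ((A \<inter> Plus) \<union> (A \<inter> Minus))"
    using assms verts_eq_Plus_Un_Minus by (intro sum.cong) auto
  also have "\<dots> = sum f (A \<inter> Plus) + sum f (A \<inter> Minus)"
    using fin Plus_Int_Minus by (intro sum.union_disjoint) auto
  also have "sum f (A \<inter> Plus) = (\<Sum>_ \<in> A \<inter> Plus. 1)"
    by (intro sum.cong) (auto simp: Plus_def)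
  also have "sum f (A \<inter> Minus) = (\<Sum>_ \<in> A \<inter> Minus. -1)"
    by (intro sum.cong) (auto simp: Minus_def)
  finally show ?thesis by simp
qed

text \<open>The domination condition at \<open>v\<close> with \<open>f v\<close> moved to the left:
  positive neighbours outnumber negative ones by at least 0 at a positive vertex and by at least 2
  at a negative one.\<close>

lemma card_nbrs_Minus_le:
  assumes "v \<in> pverts G"
  shows "1 - f v \<le> int (card (nbrs G v \<inter> Plus)) - int (card (nbrs G v \<inter> Minus))"
proof -
  have "1 \<le> sum f (closed_nbhd G v)"
    using sdf assms by (auto simp: signed_dom_funs_def)
  also have "\<dots> = f v + sum f (nbrs G v)"
    using finite_nbrs not_in_nbrs_self by (simp add: closed_nbhd_eq_insert_nbrs)
  finally show ?thesis
    using sum_eq_Plus_Minus[OF nbrs_subset_verts, of v] by linarith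
qed

lemma Plus_has_Plus_nbr:
  assumes "v \<in> Plus" "nbrs G v \<noteq> {}"
  shows "nbrs G v \<inter> Plus \<noteq> {}"
proof
  assume empty: "nbrs G v \<inter> Plus = {}"
  then have "card (nbrs G v \<inter> Minus) = 0"
    using card_nbrs_Minus_le[of v] assms(1) by (auto simp: Plus_def)
  then have "nbrs G v \<inter> Minus = {}" using finite_nbrs by auto
  then show False
    using empty assms nbrs_subset_verts verts_eq_Plus_Un_Minus by blast
qed

text \<open>Add the surplus of at least 2 positive neighbours to the equation splitting the degree
  into positive and negative neighbours.\<close>

lemma Minus_card_Plus_nbrs:
  assumes "v \<in> Minus"
  shows "deg G v + 2 \<le> 2 * card (nbrs G v \<inter> Plus)"
  using card_nbrs_Minus_le[of v] card_eq_Plus_Minus[OF nbrs_subset_verts, of v] assms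
  by (simp add: deg_eq_card_nbrs Minus_def)

lemma Minus_not_leaf:
  assumes "v \<in> Minus"
  shows "v \<notin> leaves G"
proof
  assume "v \<in> leaves G"
  then have "card (nbrs G v) = 1" by (simp add: leaves_def deg_eq_card_nbrs)
  moreover have "card (nbrs G v \<inter> Plus) \<le> card (nbrs G v)"
    by (intro card_mono finite_nbrs) auto
  ultimately show False
    using Minus_card_Plus_nbrs[OF assms] by (simp add: deg_eq_card_nbrs)
qed

text \<open>A leaf next to \<open>v\<close> would be positive with a negative vertex as its only
  neighbour, against \<open>Plus_has_Plus_nbr\<close>.\<close>

lemma Minus_not_support:
  assumes "v \<in> Minus"
  shows "v \<notin> support_verts G"
proof
  assume "v \<in> support_verts G"
  then obtain u where u: "u \<in> leaves G" "(v, u) \<in> parcs G"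
    by (auto simp: support_verts_def)
  then have "(u, v) \<in> parcs G" by (simp add: arcs_symmetric)
  then have N: "nbrs G u = {v}"
    using leaf_nbrs[OF u(1)] by (metis in_nbrs_iff singletonD)
  have "u \<in> pverts G" using u by (simp add: leaves_def)
  then have "u \<in> Plus" using u Minus_not_leaf verts_eq_Plus_Un_Minus by blast
  then show False
    using N Plus_has_Plus_nbr[of u] assms Plus_Int_Minus by auto
qed

lemma leaves_subset_Plus: "leaves G \<subseteq> Plus"
  using Minus_not_leaf verts_eq_Plus_Un_Minus by (auto simp: leaves_def)

lemma support_subset_Plus: "support_verts G \<subseteq> Plus"
  using Minus_not_support verts_eq_Plus_Un_Minus by (auto simp: support_verts_def)

text \<open>This makes degree bounds on the core, such as the one by \<open>delta_star\<close>,
  available at negative vertices.\<close>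

lemma Minus_subset_core: "Minus \<subseteq> core_verts G"
proof
  fix v assume v: "v \<in> Minus"
  have "deg G v \<noteq> 0"
  proof
    assume "deg G v = 0"
    moreover have "card (nbrs G v \<inter> Plus) \<le> card (nbrs G v)"
      by (intro card_mono finite_nbrs) auto
    ultimately show False
      using Minus_card_Plus_nbrs[OF v] by (simp add: deg_eq_card_nbrs)
  qed
  then show "v \<in> core_verts G"
    using v Minus_not_leaf Minus_not_support by (auto simp: core_verts_def Minus_def)
qed

text \<open>Choose a leaf at each support vertex. The choice is injective because a leaf has only
  one neighbour.\<close>

lemma obtain_one_leaf_per_support:
  obtains K where "K \<subseteq> leaves G" "card K = card (support_verts G)"
    "\<And>w. w \<in> support_verts G \<Longrightarrow> nbrs G w \<inter> K \<noteq> {}"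
proof -
  obtain c where c: "\<And>w. w \<in> support_verts G \<Longrightarrow> c w \<in> leaves G \<and> (w, c w) \<in> parcs G"
    by atomize_elim (rule choice, auto simp: support_verts_def)
  have "inj_on c (support_verts G)"
  proof (rule inj_onI)
    fix x y assume xy: "x \<in> support_verts G" "y \<in> support_verts G" "c x = c y"
    then have "x \<in> nbrs G (c x)" "y \<in> nbrs G (c x)"
      using c arcs_symmetric by (auto, metis)
    then show "x = y" using leaf_nbrs[of "c x"] c xy by (metis singletonD)
  qed
  then have "card (c ` support_verts G) = card (support_verts G)" by (rule card_image)
  moreover have "c w \<in> nbrs G w \<inter> c ` support_verts G" if "w \<in> support_verts G" for w
    using that c by auto
  ultimately show ?thesis using c by (intro that[of "c ` support_verts G"]) blast+
qed

text \<open>This is \<open>card P \<ge> 2 * k * card Minus + 2\<close> rewritten with \<open>card P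
  = card Plus - card (leaves G) + card (support_verts G)\<close> and arranged without subtraction.
  The hypothesis on \<open>k\<close> says that \<open>k\<close> is at most half the degree, rounded
  up, at every core vertex.\<close>

lemma card_Minus_bound:
  assumes acyc: "\<not> (\<exists>p. cycle p \<and> length p \<ge> 3)"
    and noniso: "\<And>v. v \<in> pverts G \<Longrightarrow> nbrs G v \<noteq> {}"
    and ne: "pverts G \<noteq> {}"
    and k: "\<And>v. v \<in> core_verts G \<Longrightarrow> 2 * k \<le> deg G v + 1"
  shows "(2 * k + 1) * card Minus + card (leaves G) + 2 \<le> card (pverts G) + card (support_verts G)"
proof -
  obtain K where K: "K \<subseteq> leaves G" "card K = card (support_verts G)"
    "\<And>w. w \<in> support_verts G \<Longrightarrow> nbrs G w \<inter> K \<noteq> {}"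
    using obtain_one_leaf_per_support by blast
  define P where "P = (Plus - leaves G) \<union> K"
  have P_sub: "P \<subseteq> Plus" using K leaves_subset_Plus by (auto simp: P_def)
  then have P_verts: "P \<subseteq> pverts G" and disj: "P \<inter> Minus = {}"
    using verts_eq_Plus_Un_Minus Plus_Int_Minus by auto
  have finL: "finite (leaves G)" using leaves_subset_Plus finite_Plus finite_subset by blast
  have finP: "finite P" using P_sub finite_Plus finite_subset by blast
  have "card P = card (Plus - leaves G) + card K"
    unfolding P_def using K finL finite_Plus finite_subset by (intro card_Un_disjoint) auto
  moreover have "card (Plus - leaves G) + card (leaves G) = card Plus"
    using leaves_subset_Plus finite_Plus finL
    by (simp add: card_Diff_subset card_mono)
  ultimately have card_P: "card P + card (leaves G) = card Plus + card (support_verts G)"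
    using K by simp
  have card_V: "card (pverts G) = card Plus + card Minus"
    using verts_eq_Plus_Un_Minus Plus_Int_Minus finite_Plus finite_Minus
    by (simp add: card_Un_disjoint)
  \<comment> \<open>A support vertex keeps its leaf in \<open>K\<close>. Any other vertex has a
    positive neighbour that is not a leaf and hence was not deleted.\<close>
  have P_nbr: "nbrs G v \<inter> P \<noteq> {}" if v: "v \<in> P" for v
  proof (cases "v \<in> support_verts G")
    case True
    then show ?thesis using K by (auto simp: P_def)
  next
    case False
    have "v \<in> Plus" using v P_sub by blast
    then obtain u where u: "u \<in> nbrs G v" "u \<in> Plus"
      using Plus_has_Plus_nbr noniso verts_eq_Plus_Un_Minus by blast
    have "u \<notin> leaves G"
      using False u \<open>v \<in> Plus\<close> by (auto simp: support_verts_def Plus_def)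
    then show ?thesis using u by (auto simp: P_def)
  qed
  have M_nbr: "k + 1 \<le> card (nbrs G v \<inter> P)" if v: "v \<in> Minus" for v
  proof -
    \<comment> \<open>A negative vertex is adjacent to no leaf, so the deletion costs it no
      neighbour.\<close>
    have "nbrs G v \<inter> P = nbrs G v \<inter> Plus"
      using P_sub Minus_not_support[OF v] v
      by (auto simp: P_def support_verts_def Minus_def)
    \<comment> \<open>Twice the number of positive neighbours is at least \<open>2 * k + 1\<close>;
      parity raises the number itself to \<open>k + 1\<close>.\<close>
    then show ?thesis
      using Minus_card_Plus_nbrs[OF v] k[of v] Minus_subset_core v by auto
  qed
  \<comment> \<open>\<open>PP\<close> contains both arcs of every edge inside \<open>P\<close>,
    while \<open>MP\<close> contains only one arc of every edge between \<open>Minus\<close> and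
    \<open>P\<close>. The converse of \<open>MP\<close> therefore has to be added below; edges
    inside \<open>Minus\<close> are dropped from the count.\<close>
  define PP where "PP = (SIGMA v:P. nbrs G v \<inter> P)"
  define MP where "MP = (SIGMA v:Minus. nbrs G v \<inter> P)"
  have "card P = (\<Sum>v\<in>P. 1)" by simp
  also have "\<dots> \<le> (\<Sum>v\<in>P. card (nbrs G v \<inter> P))"
    using P_nbr finP by (intro sum_mono) (simp add: Suc_le_eq card_gt_0_iff)
  also have "\<dots> = card PP"
    unfolding PP_def using finP by (intro card_SigmaI[symmetric]) auto
  finally have card_PP: "card P \<le> card PP" .
  have "(k + 1) * card Minus = (\<Sum>v\<in>Minus. k + 1)" by simp
  also have "\<dots> \<le> (\<Sum>v\<in>Minus. card (nbrs G v \<inter> P))"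
    using M_nbr by (intro sum_mono)
  also have "\<dots> = card MP"
    unfolding MP_def using finP finite_Minus by (intro card_SigmaI[symmetric]) auto
  finally have card_MP: "(k + 1) * card Minus \<le> card MP" .
  have fin: "finite PP" "finite MP"
    unfolding PP_def MP_def using finP finite_Minus by auto
  let ?W = "P \<union> Minus"
  have "card PP + (card MP + card (MP\<inverse>)) = card (PP \<union> (MP \<union> MP\<inverse>))"
    using fin disj
    by (subst card_Un_disjoint, simp, simp, force simp: PP_def MP_def,
        subst card_Un_disjoint, auto simp: PP_def MP_def)
  also have "\<dots> \<le> card (parcs G \<inter> ?W \<times> ?W)"
    using pair_finite_arcs
    by (intro card_mono) (auto simp: PP_def MP_def intro: arcs_symmetric)
  finally have "card PP + 2 * card MP \<le> card (parcs G \<inter> ?W \<times> ?W)"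
    by simp
  \<comment> \<open>If nothing remained, all vertices would be leaves and there would be no support
    vertex, although the neighbour of a leaf is one.\<close>
  moreover have "?W \<noteq> {}"
  proof
    assume "?W = {}"
    then have "Minus = {}" "Plus \<subseteq> leaves G" "K = {}" by (auto simp: P_def)
    then have "Plus \<noteq> {}" "Plus = leaves G" "support_verts G = {}"
      using ne verts_eq_Plus_Un_Minus leaves_subset_Plus K(3) by auto
    then show False using leaf_nbrs by blast
  qed
  then have "card (parcs G \<inter> ?W \<times> ?W) + 2 \<le> 2 * card ?W"
    using P_verts by (intro card_arcs_of_acyclic acyc) (auto simp: Minus_def)
  moreover have "card ?W = card P + card Minus"
    using finP finite_Minus disj by (simp add: card_Un_disjoint)
  \<comment> \<open>The two counts combine to \<open>card P + 2 * (k + 1) * card Minus + 2 \<le> 2 *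
    (card P + card Minus)\<close>.\<close>
  ultimately have "2 * k * card Minus + 2 \<le> card P"
    using card_PP card_MP by (simp add: algebra_simps)
  then show ?thesis using card_P card_V by (simp add: algebra_simps)
qed

end

section \<open>The lower bound\<close>

lemma ceiling_half_nat: "\<lceil>real m / 2\<rceil> = int ((m + 1) div 2)"
  by (cases "even m") (auto elim!: evenE oddE simp: ceiling_eq_iff)

text \<open>A minimising function has weight \<open>card (pverts T) - 2 * card Minus\<close>, and
  \<open>card_Minus_bound\<close> limits \<open>card Minus\<close> to
  \<open>(n - l + s - 2) / (2 * k + 1)\<close>, where \<open>n\<close>, \<open>l\<close>,
  \<open>s\<close> count vertices, leaves and support vertices.\<close>

lemma signed_dom_number_lower_bound:
  assumes tree: "undirected_tree T" and n: "card (pverts T) \<ge> 2"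
  defines "k \<equiv> real_of_int \<lceil>real (delta_star T) / 2\<rceil>"
  shows "((2 * k - 1) * real (card (pverts T)) +
           2 * (real (card (leaves T)) - real (card (support_verts T)) + 2)) / (2 * k + 1)
         \<le> real_of_int (signed_dom_number T)"
proof -
  \<comment> \<open>The rounded-up half of \<open>delta_star T\<close> as a natural number, for use
    in the counting lemma.\<close>
  define k' where "k' = (delta_star T + 1) div 2"
  have k: "k = real k'" by (simp add: k_def k'_def ceiling_half_nat)
  interpret pair_graph T using tree by (simp add: undirected_tree_def)
  have "signed_dom_number T \<in> (\<lambda>f. \<Sum>v \<in> pverts T. f v) ` signed_dom_funs T"
    unfolding signed_dom_number_def
    using finite_signed_dom_funs signed_dom_funs_nonempty pair_graph by (intro Min_in) auto
  then obtain f where f: "f \<in> signed_dom_funs T" "signed_dom_number T = (\<Sum>v \<in> pverts T. f v)"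
    by blast
  interpret sdf_graph T f by unfold_locales (rule f)
  have core_deg: "2 * k' \<le> deg T v + 1" if "v \<in> core_verts T" for v
  proof -
    have "finite (core_verts T)" using pair_finite_verts by (simp add: core_verts_def)
    then have "delta_star T \<le> deg T v"
      unfolding delta_star_def using that by (intro Min_le) auto
    then show ?thesis by (simp add: k'_def)
  qed
  have "(2 * k' + 1) * card Minus + card (leaves T) + 2
        \<le> card (pverts T) + card (support_verts T)"
    using tree n nbrs_nonempty_of_connected core_deg
    by (intro card_Minus_bound) (auto simp: undirected_tree_def)
  then have "real ((2 * k' + 1) * card Minus + card (leaves T) + 2)
        \<le> real (card (pverts T) + card (support_verts T))"
    by (rule of_nat_mono)
  then have bound: "(2 * k + 1) * real (card Minus) + real (card (leaves T)) + 2
        \<le> real (card (pverts T)) + real (card (support_verts T))"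
    by (simp add: k algebra_simps)
  have "pverts T \<inter> Plus = Plus" "pverts T \<inter> Minus = Minus"
    using verts_eq_Plus_Un_Minus by auto
  then have \<gamma>: "real_of_int (signed_dom_number T) = real (card (pverts T)) - 2 * real (card Minus)"
    using f(2) sum_eq_Plus_Minus[of "pverts T"] card_eq_Plus_Minus[of "pverts T"] by simp
  have "2 * k + 1 > 0" by (simp add: k)
  then show ?thesis
    unfolding \<gamma> pos_divide_le_eq[OF \<open>2 * k + 1 > 0\<close>] using bound by (simp add: algebra_simps)
qed

section \<open>Paths, and sharpness on five vertices\<close>

definition path_graph :: "nat \<Rightarrow> nat pair_pre_digraph" where
  "path_graph n = \<lparr>pverts = {..<n}, parcs = {(i, j). i < n \<and> j < n \<and> (j = Suc i \<or> i = Suc j)}\<rparr>"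

lemma pair_graph_path_graph: "pair_graph (path_graph n)"
proof unfold_locales
  show "finite (parcs (path_graph n))"
    by (rule finite_subset[of _ "{..<n} \<times> {..<n}"]) (auto simp: path_graph_def)
qed (auto simp: path_graph_def symmetric_def sym_def)

text \<open>Distinctness forbids turning back, so the walk keeps the direction of its first arc and
  ends at distance equal to its length. This excludes cycles in paths.\<close>

lemma path_graph_monotone:
  assumes "pcas x ((x, y) # q) v" "set ((x, y) # q) \<subseteq> parcs (path_graph n)"
    "distinct (pawalk_verts x ((x, y) # q))"
  shows "(y = Suc x \<and> v = x + Suc (length q)) \<or> (x = Suc y \<and> x = v + Suc (length q))"
  using assms
proof (induction q arbitrary: x y)
  case Nil
  then show ?case by (auto simp: path_graph_def)
next
  case (Cons e q)
  obtain z where e: "e = (y, z)" using Cons.prems by (cases e) auto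
  have "z \<noteq> x" using Cons.prems e by (cases q) auto
  moreover have "y = Suc x \<or> x = Suc y" using Cons.prems by (auto simp: path_graph_def)
  moreover have "(z = Suc y \<and> v = y + Suc (length q)) \<or> (y = Suc z \<and> y = v + Suc (length q))"
    using Cons.prems e by (intro Cons.IH) auto
  ultimately show ?case by auto
qed

lemma undirected_tree_path_graph:
  assumes "n > 0"
  shows "undirected_tree (path_graph n)"
  unfolding undirected_tree_def
proof (intro conjI notI)
  show "pair_graph (path_graph n)" by (rule pair_graph_path_graph)
  then interpret pair_graph "path_graph n" .
  \<comment> \<open>Any two vertices are then joined through 0 by symmetry.\<close>
  have from0: "0 \<rightarrow>\<^sup>*\<^bsub>with_proj (path_graph n)\<^esub> i" if "i < n" for i
    using that
  proof (induction i)
    case 0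
    then show ?case by (intro reachable_refl) (simp add: path_graph_def)
  next
    case (Suc i)
    then have "(i, Suc i) \<in> parcs (path_graph n)" by (auto simp: path_graph_def)
    then show ?case using Suc by (meson Suc_lessD reachable_adj_trans)
  qed
  have "strongly_connected (with_proj (path_graph n))"
  proof (rule strongly_connectedI)
    fix u v assume "u \<in> verts (with_proj (path_graph n))" "v \<in> verts (with_proj (path_graph n))"
    then have "u < n" "v < n" by (auto simp: path_graph_def)
    then show "u \<rightarrow>\<^sup>*\<^bsub>with_proj (path_graph n)\<^esub> v"
      using reachable_trans[OF symmetric_reachable[OF pair_sym_arcs from0] from0] by simp
  qed (use assms in \<open>auto simp: path_graph_def\<close>)
  then show "Digraph_Component.connected (with_proj (path_graph n))"
    using pair_sym_arcs
    by (auto simp: Digraph_Component.connected_def strongly_connected_def reachable_mk_symmetric_eq)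
  assume "\<exists>p. cycle p \<and> 3 \<le> length p"
  then obtain u p where p: "awalk u p u" "distinct (tl (pawalk_verts u p))" "length p \<ge> 3"
    unfolding cycle_def by auto
  then obtain w x q where "p = (u, w) # (w, x) # q" "q \<noteq> []"
    by (cases p; cases "tl p"; cases "tl (tl p)") (auto simp: awalk_Cons_iff)
  moreover from this have "(u, w) \<in> parcs (path_graph n)"
    using p by (simp add: awalk_Cons_iff)
  then have "w = Suc u \<or> u = Suc w"
    by (auto simp: path_graph_def)
  \<comment> \<open>Without its first arc the cycle is a path from \<open>w\<close> back to
    \<open>u\<close> of length at least 2, so \<open>w\<close> and \<open>u\<close> are at least 2
    apart; but they are adjacent.\<close>
  ultimately show False
    using p path_graph_monotone[of w x q u n] by (auto simp: awalk_Cons_iff awalk_def)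
qed

abbreviation "P5 \<equiv> path_graph 5"

lemma verts_P5: "pverts P5 = {0, 1, 2, 3, 4}"
  by (auto simp: path_graph_def)

lemma nbrs_P5: "nbrs P5 0 = {1}" "nbrs P5 1 = {0, 2}" "nbrs P5 2 = {1, 3}" "nbrs P5 3 = {2, 4}"
  "nbrs P5 4 = {3}" "nbrs P5 (Suc 0) = {0, 2}"
  by (auto simp: path_graph_def)

lemma leaves_P5: "leaves P5 = {0, 4}"
  by (auto simp: leaves_def verts_P5 deg_eq_card_nbrs nbrs_P5)

lemma support_P5: "support_verts P5 = {1, 3}"
proof -
  have "support_verts P5 = {v \<in> pverts P5. nbrs P5 v \<inter> leaves P5 \<noteq> {}}"
    by (auto simp: support_verts_def)
  then have mem: "v \<in> support_verts P5 \<longleftrightarrow> v \<in> pverts P5 \<and> nbrs P5 v \<inter> leaves P5 \<noteq> {}" for v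
    by simp
  have "v \<in> support_verts P5 \<longleftrightarrow> v \<in> {1, 3}" for v
  proof (cases "v \<in> pverts P5")
    case True
    then consider "v = 0" | "v = 1" | "v = 2" | "v = 3" | "v = 4"
      unfolding verts_P5 by blast
    then show ?thesis
      using True unfolding mem leaves_P5 by cases (simp_all add: nbrs_P5)
  next
    case False
    then show ?thesis by (auto simp: mem verts_P5)
  qed
  then show ?thesis by blast
qed

lemma core_P5: "core_verts P5 = {2}"
  by (auto simp: core_verts_def leaves_P5 support_P5 verts_P5 deg_eq_card_nbrs nbrs_P5)

lemma delta_star_P5: "delta_star P5 = 2"
  by (simp add: delta_star_def core_P5 deg_eq_card_nbrs nbrs_P5)

lemma signed_dom_number_P5: "signed_dom_number P5 \<le> 3"
proof -
  \<comment> \<open>The centre 2 is the only core vertex, hence the only one that can be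
    negative.\<close>
  define f :: "nat \<Rightarrow> int" where "f = restrict (\<lambda>v. if v = 2 then -1 else 1) (pverts P5)"
  have "f \<in> signed_dom_funs P5"
    by (auto simp: signed_dom_funs_def f_def verts_P5 closed_nbhd_eq_insert_nbrs nbrs_P5)
  moreover have "(\<Sum>v \<in> pverts P5. f v) = 3"
    by (simp add: f_def verts_P5)
  ultimately show ?thesis
    unfolding signed_dom_number_def
    using finite_signed_dom_funs[of P5] pair_graph_path_graph
    by (intro Min_le) force+
qed

lemma sharp_P5:
  "undirected_tree P5" "card (pverts P5) = 5" "card (leaves P5) = 2" "card (support_verts P5) = 2"
  "core_verts P5 \<noteq> {}" "delta_star P5 = 2" "signed_dom_number P5 = 3"
proof -
  show tree: "undirected_tree P5" by (simp add: undirected_tree_path_graph)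
  show cards: "card (pverts P5) = 5" "card (leaves P5) = 2" "card (support_verts P5) = 2"
    by (simp_all add: verts_P5 leaves_P5 support_P5)
  show "core_verts P5 \<noteq> {}" "delta_star P5 = 2" by (simp_all add: core_P5 delta_star_P5)
  \<comment> \<open>Here the rounded-up half of \<open>delta_star P5\<close> is 1, and the lower
    bound is \<open>(1 * 5 + 2 * (2 - 2 + 2)) / 3 = 3\<close>.\<close>
  show "signed_dom_number P5 = 3"
    using signed_dom_number_lower_bound[OF tree] signed_dom_number_P5
    by (simp add: cards delta_star_P5)
qed

theorem theorem3p4:
  shows "(\<forall>(T :: 'a pair_pre_digraph) n l s.
            undirected_tree T \<and> n = card (pverts T) \<and> n \<ge> 2 \<and>
            l = card (leaves T) \<and> s = card (support_verts T) \<and> core_verts T \<noteq> {} \<longrightarrow>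
            real_of_int (signed_dom_number T) \<ge>
              ((2 * real_of_int \<lceil>real (delta_star T) / 2\<rceil> - 1) * real n + 2 * (real l - real s + 2))
              / (2 * real_of_int \<lceil>real (delta_star T) / 2\<rceil> + 1))
       \<and> (\<exists>(T :: nat pair_pre_digraph) n l s.
            undirected_tree T \<and> n = card (pverts T) \<and> n \<ge> 2 \<and>
            l = card (leaves T) \<and> s = card (support_verts T) \<and> core_verts T \<noteq> {} \<and>
            real_of_int (signed_dom_number T) =
              ((2 * real_of_int \<lceil>real (delta_star T) / 2\<rceil> - 1) * real n + 2 * (real l - real s + 2))
              / (2 * real_of_int \<lceil>real (delta_star T) / 2\<rceil> + 1))"
proof (intro conjI allI impI)
  show "\<exists>(T :: nat pair_pre_digraph) n l s.
            undirected_tree T \<and> n = card (pverts T) \<and> n \<ge> 2 \<and>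
            l = card (leaves T) \<and> s = card (support_verts T) \<and> core_verts T \<noteq> {} \<and>
            real_of_int (signed_dom_number T) =
              ((2 * real_of_int \<lceil>real (delta_star T) / 2\<rceil> - 1) * real n + 2 * (real l - real s + 2))
              / (2 * real_of_int \<lceil>real (delta_star T) / 2\<rceil> + 1)"
    using sharp_P5 by (intro exI[of _ "path_graph 5"] exI conjI, (rule refl | simp)+)
qed (use signed_dom_number_lower_bound in blast)

end
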